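(* Let $\Delta_3^rW=\Delta_3^r x_{i_1}^{s_1}x_{i_2}^{s_2}\cdots x_{i_h}^{s_h}$ be a summit word, written in syllable form. Then it is a super summit word if and only if one of the following holds: (0) $\Delta_3^rW$ is of the form $\Delta_3^{r}$ with $r$ even, or $\Delta_3^{r}x_i$ with $r$ odd and $i\in\{1,2\}$, or $\Delta_3^{r}x_{i_1}x_{i_2}$ with $r$ even; or (i) $h+1\equiv r\pmod 2$.
   Context: $\mathcal{B}_3=\langle x_1,x_2 : x_2x_1x_2=x_1x_2x_1\rangle$ is the 3-braid group. $\mathcal{MB}_3\subset\mathcal{B}_3$ is the monoid of positive elements (products of $x_1,x_2$). $\Delta_3=x_1x_2x_1$, and $\mathcal{MB}_3^+=\mathcal{MB}_3\setminus\Delta_3\mathcal{MB}_3$. Every element of $\mathcal{B}_3$ is uniquely $\Delta_3^rW$ with $r\in\mathbb{Z}$, $W\in\mathcal{MB}_3^+$ (Garside normal form). Syllable form of $W$: $W=x_{i_1}^{s_1}\cdots x_{i_h}^{s_h}$ with $h\ge0$, $i_j\in\{1,2\}$, $i_j\ne i_{j+1}$, $s_j\ge1$ ($h=0$ means $W=1$). For a conjugacy class $C$ of $\mathcal{B}_3$, $\exp(C)$ is the maximum (which exists, by Garside) of the integers $r$ such that $\Delta_3^rW\in C$ for some $W\in\mathcal{MB}_3^+$. The summit set is $SS(C)=\{\Delta_3^rW\in C : W\in\mathcal{MB}_3^+,\ r=\exp(C)\}$. An expression $\Delta_3^rW$ in normal form is a summit word if it belongs to the summit set of its conjugacy class. Let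 $Div=\{1,x_1,x_2,x_1x_2,x_2x_1,\Delta_3\}$ be the set of divisors of $\Delta_3$. The left-canonical form of $V=\Delta_3^rW$ (normal form) is the expression $V=\Delta_3^rA_1\cdots A_q$ with $W=A_1\cdots A_q$, $A_i\in Div\setminus\{1,\Delta_3\}$, such that for each $1\le j<q$, whenever $A_{j+1}=x_kB$ with $B\in\mathcal{MB}_3^+$ one has $A_j=Cx_k$ for some $C\in\mathcal{MB}_3^+$. The number $q$ is the canonical length of $V$. The super summit set $SSS(C)$ is the set of elements $\Delta_3^rW$ of $SS(C)$ whose canonical length is minimal among elements of $SS(C)$. A super summit word is a word in normal form belonging to the super summit set of its conjugacy class. *)

theory Defs
  imports "HOL-Number_Theory.Cong"
begin

datatype gen_idx = I1 | I2

text \<open>The letter \<open>(i, True)\<close> stands for the generator \<open>xgen i\<close>, and \<open>(i, False)\<close> for its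
  inverse. The relation \<open>braid_eq\<close> is the congruence on signed words generated by free cancellation
  and the braid relation, so its quotient is the group presented by
  \<open>xgen I1, xgen I2\<close> with \<open>xgen I2 * xgen I1 * xgen I2 = xgen I1 * xgen I2 * xgen I1\<close>.\<close>

type_synonym braid_word = "(gen_idx \<times> bool) list"

inductive braid_eq :: "braid_word \<Rightarrow> braid_word \<Rightarrow> bool" where
  refl: "braid_eq u u"
| sym: "braid_eq u v \<Longrightarrow> braid_eq v u"
| trans: "braid_eq u v \<Longrightarrow> braid_eq v w \<Longrightarrow> braid_eq u w"
| ctxt: "braid_eq u v \<Longrightarrow> braid_eq (a @ u @ b) (a @ v @ b)"
| cancel: "braid_eq [(i, e), (i, \<not> e)] []"
| braid: "braid_eq [(I2, True), (I1, True), (I2, True)] [(I1, True), (I2, True), (I1, True)]"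

lemma braid_eq_equivp: "equivp braid_eq"
  by (rule equivpI)
    (auto simp: reflp_def symp_def transp_def
      intro: braid_eq.refl braid_eq.sym braid_eq.trans)

quotient_type braid3 = braid_word / braid_eq
  by (rule braid_eq_equivp)

definition inv_word :: "braid_word \<Rightarrow> braid_word" where
  "inv_word w = map (\<lambda>(i, e). (i, \<not> e)) (rev w)"

lemma inv_word_append: "inv_word (u @ v) = inv_word v @ inv_word u"
  by (simp add: inv_word_def)

lemma inv_word_inv_word [simp]: "inv_word (inv_word w) = w"
  by (simp add: inv_word_def rev_map comp_def case_prod_beta)

lemma braid_eq_append:
  assumes "braid_eq u u'" "braid_eq v v'"
  shows "braid_eq (u @ v) (u' @ v')"
  using braid_eq.ctxt[OF assms(1), of "[]" v] braid_eq.ctxt[OF assms(2), of u' "[]"]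
  by (auto intro: braid_eq.trans)

lemma braid_eq_inv_right: "braid_eq (w @ inv_word w) []"
proof (induction w)
  case Nil
  show ?case by (simp add: inv_word_def braid_eq.refl)
next
  case (Cons p w)
  obtain i e where p: "p = (i, e)" by (cases p)
  have "braid_eq ([p] @ (w @ inv_word w) @ [(i, \<not> e)]) ([p] @ [] @ [(i, \<not> e)])"
    using Cons.IH by (rule braid_eq.ctxt)
  moreover have "braid_eq ([p] @ [] @ [(i, \<not> e)]) []"
    by (simp add: p braid_eq.cancel)
  ultimately show ?case
    by (simp add: p inv_word_def) (blast intro: braid_eq.trans)
qed

lemma braid_eq_inv_left: "braid_eq (inv_word w @ w) []"
  using braid_eq_inv_right[of "inv_word w"] by simp

lemma braid_eq_inv_word:
  assumes "braid_eq u v"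
  shows "braid_eq (inv_word u) (inv_word v)"
proof -
  have "braid_eq (inv_word u @ v @ inv_word v) (inv_word u @ [])"
    by (intro braid_eq_append braid_eq.refl braid_eq_inv_right)
  moreover have "braid_eq (inv_word u @ v @ inv_word v) (inv_word u @ u @ inv_word v)"
    by (intro braid_eq_append braid_eq.refl braid_eq.sym[OF assms])
  moreover have "braid_eq ((inv_word u @ u) @ inv_word v) ([] @ inv_word v)"
    by (intro braid_eq_append braid_eq.refl braid_eq_inv_left)
  ultimately show ?thesis
    by simp (meson braid_eq.sym braid_eq.trans)
qed

instantiation braid3 :: "{monoid_mult, inverse}"
begin

lift_definition one_braid3 :: braid3 is "[]" .

lift_definition times_braid3 :: "braid3 \<Rightarrow> braid3 \<Rightarrow> braid3" is "(@)"
  by (rule braid_eq_append)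

lift_definition inverse_braid3 :: "braid3 \<Rightarrow> braid3" is inv_word
  by (rule braid_eq_inv_word)

definition divide_braid3 :: "braid3 \<Rightarrow> braid3 \<Rightarrow> braid3" where
  "divide_braid3 a b = a * inverse b"

instance
  by standard (transfer; simp add: braid_eq.refl)+

end

lift_definition xgen :: "gen_idx \<Rightarrow> braid3" is "\<lambda>i. [(i, True)]" .

lemma braid3_left_inverse: "inverse a * a = (1 :: braid3)"
  by transfer (rule braid_eq_inv_left)

lemma braid3_right_inverse: "a * inverse a = (1 :: braid3)"
  by transfer (rule braid_eq_inv_right)

lemma braid3_relation: "xgen I2 * xgen I1 * xgen I2 = xgen I1 * xgen I2 * xgen I1"
  by transfer (simp add: braid_eq.braid)

inductive_set MB3 :: "braid3 set" where
  one: "1 \<in> MB3"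
| step: "W \<in> MB3 \<Longrightarrow> xgen i * W \<in> MB3"

definition Delta :: braid3 where
  "Delta = xgen I1 * xgen I2 * xgen I1"

definition MB3_plus :: "braid3 set" where
  "MB3_plus = MB3 - (\<lambda>M. Delta * M) ` MB3"

text \<open>A syllable list \<open>[(i\<^sub>1, s\<^sub>1), \<dots>, (i\<^sub>h, s\<^sub>h)]\<close> encodes
  \<open>xgen i\<^sub>1 ^ s\<^sub>1 * \<dots> * xgen i\<^sub>h ^ s\<^sub>h\<close>.\<close>

definition syllable_form :: "(gen_idx \<times> nat) list \<Rightarrow> braid3 \<Rightarrow> bool" where
  "syllable_form ss W \<longleftrightarrow>
     distinct_adj (map fst ss) \<and> (\<forall>(i, s) \<in> set ss. s \<ge> 1) \<and>
     W = prod_list (map (\<lambda>(i, s). xgen i ^ s) ss)"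

definition conj_class :: "braid3 \<Rightarrow> braid3 set" where
  "conj_class V = {g * V * inverse g | g. True}"

text \<open>In the following definitions the set \<open>C\<close> is meant to be a conjugacy class; the maximum
  exists in that case.\<close>

definition exp_class :: "braid3 set \<Rightarrow> int" where
  "exp_class C = (GREATEST r. \<exists>W \<in> MB3_plus. Delta powi r * W \<in> C)"

definition SS :: "braid3 set \<Rightarrow> braid3 set" where
  "SS C = {Delta powi r * W | r W. W \<in> MB3_plus \<and> r = exp_class C \<and> Delta powi r * W \<in> C}"

definition summit_word :: "int \<Rightarrow> braid3 \<Rightarrow> bool" where
  "summit_word r W \<longleftrightarrow> W \<in> MB3_plus \<and> Delta powi r * W \<in> SS (conj_class (Delta powi r * W))"

definition Div :: "braid3 set" where
  "Div = {1, xgen I1, xgen I2, xgen I1 * xgen I2, xgen I2 * xgen I1, Delta}"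

definition left_canonical_form :: "braid3 \<Rightarrow> int \<Rightarrow> braid3 list \<Rightarrow> bool" where
  "left_canonical_form V r As \<longleftrightarrow>
     V = Delta powi r * prod_list As \<and> prod_list As \<in> MB3_plus \<and> set As \<subseteq> Div - {1, Delta} \<and>
     (\<forall>j. Suc j < length As \<longrightarrow>
        (\<forall>k. \<forall>B \<in> MB3_plus. As ! Suc j = xgen k * B \<longrightarrow> (\<exists>C \<in> MB3_plus. As ! j = C * xgen k)))"

text \<open>The description is proper because every braid has exactly one left-canonical form.\<close>

definition canonical_length :: "braid3 \<Rightarrow> nat" where
  "canonical_length V = (THE q. \<exists>r As. left_canonical_form V r As \<and> q = length As)"

definition SSS :: "braid3 set \<Rightarrow> braid3 set" where
  "SSS C = {V \<in> SS C. \<forall>U \<in> SS C. canonical_length V \<le> canonical_length U}"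

definition super_summit_word :: "int \<Rightarrow> braid3 \<Rightarrow> bool" where
  "super_summit_word r W \<longleftrightarrow> W \<in> MB3_plus \<and> Delta powi r * W \<in> SSS (conj_class (Delta powi r * W))"

end

theory Submission
  imports Defs
begin

text \<open>A positive word represents an element of \<open>MB3_plus\<close> iff it has no factor \<open>aba\<close> with \<open>a \<noteq> b\<close>. The
  group acts faithfully on pairs of an exponent and such a word, so normal forms are unique, and the
  canonical length of \<open>Delta\<^sup>r w\<close> is the length of \<open>w\<close> minus its number of changes of letter. The length
  is constant on a summit set, hence super summit words are the ones with the most changes. Reading
  \<open>w\<close> cyclically, with a twist by \<open>Delta\<^sup>r\<close>, the number of changes is a conjugacy invariant: it is
  the growth rate of the number of changes in the powers. The number of changes of \<open>w\<close> itself is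
  this invariant, or one less when there is a change at the junction; the condition \<open>h + 1 \<equiv> r\<close> says
  that there is none. If there is one, rotating \<open>w\<close> to cut it between two equal letters gains a change,
  and a word without adjacent equal letters has length at most two.\<close>

section \<open>Words in the generators\<close>

fun flip :: "gen_idx \<Rightarrow> gen_idx" where
  "flip I1 = I2"
| "flip I2 = I1"

lemma flip_neq [simp]: "flip i \<noteq> i" "i \<noteq> flip i"
  by (cases i; simp)+

lemma flip_flip [simp]: "flip (flip i) = i"
  by (cases i) auto

lemma flip_inject [simp]: "flip i = flip j \<longleftrightarrow> i = j"
  by (cases i; cases j) auto

lemma neq_imp_flip: "i \<noteq> j \<Longrightarrow> j = flip i"
  by (cases i; cases j) auto

text \<open>Conjugation by \<open>Delta powi r\<close> on the generators: \<open>Delta\<close> swaps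
  the two, so only the parity of \<open>r\<close> matters.\<close>

definition twist :: "int \<Rightarrow> gen_idx \<Rightarrow> gen_idx" where
  "twist r i = (if even r then i else flip i)"

lemma twist_inject [simp]: "twist r i = twist r j \<longleftrightarrow> i = j"
  by (simp add: twist_def)

lemma twist_0 [simp]: "twist 0 i = i"
  by (simp add: twist_def)

lemma twist_twist [simp]: "twist r (twist s i) = twist (r + s) i"
  by (auto simp: twist_def)

lemma flip_twist: "flip (twist r i) = twist r (flip i)"
  by (simp add: twist_def)

section \<open>Letter changes of a word\<close>

fun changes :: "'a list \<Rightarrow> nat" where
  "changes (a # b # w) = (if a = b then 0 else 1) + changes (b # w)"
| "changes _ = 0"

lemma changes_append:
  assumes "u \<noteq> []" "v \<noteq> []"
  shows "changes (u @ v) = changes u + (if last u = hd v then 0 else 1) + changes v"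
  using assms
proof (induction u rule: changes.induct)
  case ("2_2" a)
  then show ?case by (cases v) auto
qed auto

lemma changes_rev [simp]: "changes (rev w) = changes w"
proof (induction w rule: changes.induct)
  case (1 a b w)
  then show ?case
    using changes_append[of "rev (b # w)" "[a]"] by (auto simp: last_rev)
qed auto

lemma changes_map: "inj f \<Longrightarrow> changes (map f w) = changes w"
  by (induction w rule: changes.induct) (simp_all add: inj_eq)

lemma changes_map_twist [simp]: "changes (map (twist r) w) = changes w"
  by (rule changes_map) (simp add: inj_def)

lemma changes_less_length: "w \<noteq> [] \<Longrightarrow> changes w < length w"
  by (induction w rule: changes.induct) auto

lemma changes_le_length: "changes w \<le> length w"
  by (cases "w = []") (auto dest: changes_less_length)

lemma changes_replicate [simp]: "changes (replicate n a) = 0"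
proof (induction n)
  case (Suc n)
  then show ?case by (cases n) auto
qed simp

text \<open>With only two letters every change is a flip. This link between parity and end letters
  later turns the congruence modulo 2 into a condition on the junction.\<close>

lemma last_eq_twist_changes: "w \<noteq> [] \<Longrightarrow> last w = twist (int (changes w)) (hd w)"
proof (induction w rule: changes.induct)
  case (1 a b w)
  then show ?case by (cases a; cases b) (auto simp: twist_def)
qed auto

section \<open>Words without a factor \<open>aba\<close>\<close>

fun aba_free :: "'a list \<Rightarrow> bool" where
  "aba_free (a # b # c # w) \<longleftrightarrow> (a = b \<or> a \<noteq> c) \<and> aba_free (b # c # w)"
| "aba_free _ \<longleftrightarrow> True"

lemma aba_free_ConsD: "aba_free (a # w) \<Longrightarrow> aba_free w"
  by (cases "a # w" rule: aba_free.cases) auto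

lemma aba_free_appendD1: "aba_free (u @ v) \<Longrightarrow> aba_free u"
  by (induction u rule: aba_free.induct) simp_all

lemma aba_free_appendD2: "aba_free (u @ v) \<Longrightarrow> aba_free v"
  by (induction u) (simp, metis append_Cons aba_free_ConsD)

text \<open>A factor meeting both \<open>u\<close> and \<open>x\<close> contains all of
  \<open>v\<close>, so it has at least four letters and cannot be an \<open>aba\<close>.\<close>

lemma aba_free_glue:
  assumes "aba_free (u @ v)" "aba_free (v @ x)" "length v \<ge> 2"
  shows "aba_free (u @ v @ x)"
proof -
  obtain a b v' where v: "v = a # b # v'"
    using assms(3) by (auto simp: numeral_2_eq_2 Suc_le_length_iff)
  have "aba_free (u @ a # b # v' @ x)"
    using assms(1,2) unfolding v by (induction u rule: aba_free.induct) auto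
  then show ?thesis
    using v by simp
qed

lemma aba_free_map: "inj f \<Longrightarrow> aba_free (map f w) = aba_free w"
  by (induction w rule: aba_free.induct) (simp_all add: inj_eq)

lemma aba_free_map_twist [simp]: "aba_free (map (twist r) w) = aba_free w"
  by (rule aba_free_map) (simp add: inj_def)

lemma aba_free_rev [simp]: "aba_free (rev w) = aba_free w"
proof -
  have *: "aba_free (rev w)" if "aba_free w" for w :: "'a list"
    using that
  proof (induction w rule: aba_free.induct)
    case (1 a b c w)
    then show ?case
      using aba_free_glue[of "rev w" "[c, b]" "[a]"] by auto
  qed auto
  show ?thesis
    using *[of w] *[of "rev w"] by auto
qed

section \<open>Normal forms\<close>

text \<open>The pair \<open>(r, w)\<close> stands for \<open>Delta powi r\<close> times the word \<open>w\<close>; \<open>act\<close> is left multiplication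
  by a letter, where \<open>inverse x\<^sub>j = Delta powi (- 1) * x\<^sub>j * x\<^sub>k\<close> for \<open>k \<noteq> j\<close>.\<close>

fun act :: "gen_idx \<times> bool \<Rightarrow> int \<times> gen_idx list \<Rightarrow> int \<times> gen_idx list" where
  "act (i, True) (r, w) =
     (if aba_free (twist r i # w) then (r, twist r i # w) else (r + 1, drop 2 w))"
| "act (i, False) (r, w) =
     (if w \<noteq> [] \<and> hd w = twist r i then (r, tl w) else (r - 1, twist r i # flip (twist r i) # w))"

text \<open>A new first letter can only spoil the front of the word. If it does, a third letter
  \<open>flip i\<close> would give \<open>w\<close> itself an \<open>aba\<close>, so the rest is
  empty or starts with \<open>i\<close>.\<close>

lemma aba_free_Cons_cases:
  fixes i :: gen_idx
  assumes "aba_free w"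
  obtains "aba_free (i # w)" | w' where "w = flip i # i # w'" "aba_free w'" "w' = [] \<or> hd w' = i"
proof (cases "aba_free (i # w)")
  case False
  then obtain b c w' where w: "w = b # c # w'" "i = c" "i \<noteq> b"
    using assms by (cases "i # w" rule: aba_free.cases) auto
  then have "w = flip i # i # w'"
    using neq_imp_flip by blast
  moreover have "w' = [] \<or> hd w' = i"
  proof (cases w')
    case (Cons d w'')
    then have "d \<noteq> b" using assms w by auto
    then show ?thesis using w Cons by (cases b; cases c; cases d) auto
  qed simp
  ultimately show ?thesis
    using that assms aba_free_ConsD by metis
qed

lemma aba_free_inverse_cons:
  fixes i :: gen_idx
  assumes "aba_free w" "w = [] \<or> hd w \<noteq> i"
  shows "aba_free (i # flip i # w)"
  using assms
proof (cases w)
  case (Cons a w')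
  then have "a = flip i"
    using assms neq_imp_flip[of i a] by auto
  then show ?thesis
    using assms Cons by (cases w') auto
qed auto

lemma aba_free_act: "aba_free (snd p) \<Longrightarrow> aba_free (snd (act l p))"
proof (induction l p rule: act.induct)
  case (1 i r w)
  then have "aba_free w" by simp
  then show ?case
    by (cases rule: aba_free_Cons_cases[of w "twist r i"]) auto
next
  case (2 i r w)
  then have "aba_free (tl w)"
    by (cases w) (simp_all add: aba_free_ConsD)
  then show ?case
    using 2 aba_free_inverse_cons[of w "twist r i"] by auto
qed

lemma aba_free_foldr_act: "aba_free (snd p) \<Longrightarrow> aba_free (snd (foldr act u p))"
  by (induction u) (auto simp: aba_free_act simp del: act.simps)

lemma twist_flip_Suc: "twist (r + 1) i = flip (twist r i)" "twist (r - 1) i = flip (twist r i)"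
  by (auto simp: twist_def)

text \<open>With both values of \<open>e\<close> this makes the two signs of a letter act as
  mutually inverse permutations of the pairs, as free cancellation requires.\<close>

lemma act_cancel:
  assumes "aba_free (snd p)"
  shows "act (i, e) (act (i, \<not> e) p) = p"
proof -
  obtain r w where p: "p = (r, w)" by (cases p)
  define j where "j = twist r i"
  have w: "aba_free w" using assms p by simp
  show ?thesis
  proof (cases e)
    case True
    show ?thesis
    proof (cases "w \<noteq> [] \<and> hd w = j")
      case True
      then show ?thesis
        using w \<open>e\<close> p by (cases w) (auto simp: j_def)
    next
      case False
      then show ?thesis
        using w \<open>e\<close> p by (auto simp: j_def twist_flip_Suc)
    qed
  next
    case False
    from w show ?thesis
    proof (cases rule: aba_free_Cons_cases[of w j])
      case 1
      then show ?thesis using False p by (simp add: j_def)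
    next
      case (2 w')
      then show ?thesis
        using False p by (auto simp: j_def twist_flip_Suc)
    qed
  qed
qed

text \<open>The result does not mention \<open>i\<close>: both sides of the braid relation act by
  raising the exponent by one.\<close>

lemma act_Delta:
  assumes "aba_free w"
  shows "act (i, True) (act (flip i, True) (act (i, True) (r, w))) = (r + 1, w)"
proof -
  define j where "j = twist r i"
  have j: "twist r i = j" "twist r (flip i) = flip j" "twist (r + 1) i = flip j"
      "twist (r + 1) (flip i) = j"
    by (auto simp: j_def flip_twist twist_flip_Suc)
  from assms show ?thesis
  proof (cases rule: aba_free_Cons_cases[of w j])
    case 1
    then show ?thesis
    proof (cases w)
      case Nil
      then show ?thesis using j by simp
    next
      case (Cons a w')
      show ?thesis
      proof (cases "a = j")
        case True
        then show ?thesis using j 1 Cons by simp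
      next
        case False
        then have "a = flip j" using neq_imp_flip[of j a] by auto
        then show ?thesis using j 1 Cons by (cases w') auto
      qed
    qed
  next
    case (2 w')
    have "aba_free (j # w')" "aba_free (flip j # j # w')"
      using 2 assms aba_free_ConsD by metis+
    then show ?thesis using j 2 by auto
  qed
qed

lemma foldr_act_braid_eq:
  assumes "braid_eq u v" "aba_free (snd p)"
  shows "foldr act u p = foldr act v p"
  using assms
proof (induction arbitrary: p rule: braid_eq.induct)
  case (ctxt u v a b)
  then show ?case by (simp add: aba_free_foldr_act)
next
  case (cancel i e)
  then show ?case by (simp add: act_cancel del: act.simps)
next
  case braid
  then show ?case
    using act_Delta[of "snd p" I1 "fst p"] act_Delta[of "snd p" I2 "fst p"]
    by (simp del: act.simps)
qed auto

text \<open>The image of the base pair \<open>(0, [])\<close> under the action. As it depends on the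
  group element only, normal forms are unique without any confluence argument for rewriting.\<close>

lift_definition nf :: "braid3 \<Rightarrow> int \<times> gen_idx list" is "\<lambda>u. foldr act u (0, [])"
  by (rule foldr_act_braid_eq) auto

lemma aba_free_nf [simp]: "aba_free (snd (nf V))"
  by transfer (simp add: aba_free_foldr_act)

lemma nf_1 [simp]: "nf 1 = (0, [])"
  by transfer simp

lemma nf_xgen: "nf (xgen i * V) = act (i, True) (nf V)"
  by transfer (simp del: act.simps)

lemma nf_inverse_xgen: "nf (inverse (xgen i) * V) = act (i, False) (nf V)"
  by transfer (simp add: inv_word_def del: act.simps)

lemma braid3_induct [case_names one gen inverse_gen]:
  assumes "P 1" "\<And>i V. P V \<Longrightarrow> P (xgen i * V)" "\<And>i V. P V \<Longrightarrow> P (inverse (xgen i) * V)"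
  shows "P (V :: braid3)"
proof -
  have "P (abs_braid3 u)" for u
  proof (induction u)
    case Nil
    then show ?case using assms(1) by (simp add: one_braid3.abs_eq)
  next
    case (Cons l u)
    obtain i e where l: "l = (i, e)" by (cases l)
    have "abs_braid3 (l # u) = (if e then xgen i else inverse (xgen i)) * abs_braid3 u"
      by (auto simp: l times_braid3.abs_eq xgen.abs_eq inverse_braid3.abs_eq inv_word_def)
    then show ?case using Cons assms(2,3) by (auto split: if_splits)
  qed
  then show ?thesis
    by (rule braid3.abs_induct)
qed

lemma braid3_left_inverse' [simp]: "inverse a * (a * b) = (b :: braid3)"
  by (metis braid3_left_inverse mult.assoc mult_1_left)

lemma braid3_right_inverse' [simp]: "a * (inverse a * b) = (b :: braid3)"
  by (metis braid3_right_inverse mult.assoc mult_1_left)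

lemma braid3_left_cancel [simp]: "a * b = a * c \<longleftrightarrow> b = (c :: braid3)"
  by (metis braid3_left_inverse')

declare braid3_left_inverse [simp] braid3_right_inverse [simp]

lemma braid3_inverse_unique: "a * b = 1 \<Longrightarrow> inverse a = (b :: braid3)"
  by (metis braid3_left_inverse' mult_1_right)

lemma braid3_inverse_mult: "inverse (a * b) = inverse b * inverse (a :: braid3)"
  by (rule braid3_inverse_unique) (simp add: mult.assoc)

section \<open>Commutation with powers of \<open>Delta\<close>\<close>

lemma Delta_eq: "Delta = xgen i * (xgen (flip i) * xgen i)"
  using braid3_relation by (cases i) (simp_all add: Delta_def mult.assoc)

lemma xgen_mult_Delta: "xgen i * Delta = Delta * xgen (flip i)"
  by (metis Delta_eq flip_flip mult.assoc)

lemma Delta_powi_Suc: "Delta powi (r + 1) = Delta * Delta powi r"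
proof (cases "r \<ge> 0")
  case True
  then have "nat (r + 1) = Suc (nat r)" by linarith
  then show ?thesis using True by (simp add: power_int_def)
next
  case False
  then have *: "nat (- r) = Suc (nat (- (r + 1)))" by linarith
  show ?thesis
  proof (cases "r = -1")
    case False
    then have "\<not> r + 1 \<ge> 0" using \<open>\<not> r \<ge> 0\<close> by linarith
    then show ?thesis using * \<open>\<not> r \<ge> 0\<close> by (simp add: power_int_def mult.assoc)
  qed (simp add: power_int_def)
qed

lemma Delta_powi_pred: "Delta powi (r - 1) = inverse Delta * Delta powi r"
  using Delta_powi_Suc[of "r - 1"] by simp

lemma Delta_powi_0 [simp]: "Delta powi 0 = 1"
  by (simp add: power_int_def)

lemma Delta_powi_add: "Delta powi (r + s) = Delta powi r * Delta powi s"
proof (induction r rule: int_induct[where k = 0])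
  case (step1 i)
  have "i + 1 + s = i + s + 1" by simp
  then show ?case
    using step1 by (simp only: Delta_powi_Suc mult.assoc)
next
  case (step2 i)
  have "i - 1 + s = i + s - 1" by simp
  then show ?case
    using step2 by (simp only: Delta_powi_pred mult.assoc)
qed simp

lemma xgen_mult_Delta_powi: "xgen i * Delta powi r = Delta powi r * xgen (twist r i)"
proof (induction r arbitrary: i rule: int_induct[where k = 0])
  case (step1 r)
  have "xgen i * Delta powi (r + 1) = Delta * (xgen (flip i) * Delta powi r)"
    by (metis Delta_powi_Suc mult.assoc xgen_mult_Delta)
  then show ?case
    using step1 by (simp add: Delta_powi_Suc mult.assoc twist_flip_Suc flip_twist)
next
  case (step2 r)
  have "xgen i * inverse Delta = inverse Delta * xgen (flip i)"
    by (metis xgen_mult_Delta flip_flip braid3_left_inverse' braid3_right_inverse mult.assoc mult_1_right)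
  then have "xgen i * Delta powi (r - 1) = inverse Delta * (xgen (flip i) * Delta powi r)"
    by (metis Delta_powi_pred mult.assoc)
  then show ?case
    using step2 by (simp add: Delta_powi_pred mult.assoc twist_flip_Suc flip_twist)
qed simp

definition eval_word :: "gen_idx list \<Rightarrow> braid3" where
  "eval_word w = prod_list (map xgen w)"

lemma eval_word_simps [simp]:
  "eval_word [] = 1"
  "eval_word (i # w) = xgen i * eval_word w"
  "eval_word (u @ v) = eval_word u * eval_word v"
  by (simp_all add: eval_word_def)

lemma eval_word_mult_Delta_powi:
  "eval_word w * Delta powi r = Delta powi r * eval_word (map (twist r) w)"
proof (induction w)
  case (Cons i w)
  then show ?case by simp (metis mult.assoc xgen_mult_Delta_powi)
qed simp

lemma nf_Delta: "nf (Delta * V) = (fst (nf V) + 1, snd (nf V))"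
  using act_Delta[of "snd (nf V)" I1 "fst (nf V)"]
  by (simp add: Delta_def mult.assoc nf_xgen del: act.simps)

lemma nf_Delta_powi: "nf (Delta powi r * V) = (fst (nf V) + r, snd (nf V))"
proof (induction r rule: int_induct[where k = 0])
  case (step1 r)
  then show ?case by (simp add: Delta_powi_Suc mult.assoc nf_Delta)
next
  case (step2 r)
  have "nf (Delta powi r * V) = nf (Delta * (Delta powi (r - 1) * V))"
    by (simp add: Delta_powi_pred mult.assoc)
  then show ?case using step2
    by (auto simp: nf_Delta prod_eq_iff)
qed simp

lemma nf_eval_word: "aba_free w \<Longrightarrow> nf (eval_word w) = (0, w)"
proof (induction w)
  case (Cons i w)
  then show ?case using aba_free_ConsD[of i w] by (simp add: nf_xgen)
qed simp

lemma fst_act_True: "fst (act (i, True) p) \<ge> fst p"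
  by (cases p) simp

lemma fst_nf_eval_word_nonneg: "fst (nf (eval_word w)) \<ge> 0"
proof (induction w)
  case (Cons i w)
  then show ?case using fst_act_True[of "nf (eval_word w)" i] by (simp add: nf_xgen del: act.simps)
qed simp

text \<open>Reading from the right, the first letter that completes an \<open>aba\<close> raises the
  exponent, and positive letters never lower it again.\<close>

lemma fst_nf_eval_word_pos: "\<not> aba_free w \<Longrightarrow> fst (nf (eval_word w)) > 0"
proof (induction w)
  case (Cons i w)
  show ?case
  proof (cases "aba_free w")
    case True
    then show ?thesis using Cons by (simp add: nf_xgen nf_eval_word)
  next
    case False
    then show ?thesis
      using Cons fst_act_True[of "nf (eval_word w)" i] by (simp add: nf_xgen del: act.simps)
  qed
qed simp

lemma xgen_Delta_powi_mult: "xgen i * (Delta powi r * V) = Delta powi r * (xgen (twist r i) * V)"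
  by (metis mult.assoc xgen_mult_Delta_powi)

lemma inverse_xgen: "inverse (xgen i) = Delta powi (- 1) * (xgen i * xgen (flip i))"
proof (rule braid3_inverse_unique)
  \<comment> \<open>On passing \<open>Delta powi (- 1)\<close> the outer \<open>xgen i\<close>
    becomes \<open>xgen (flip i)\<close>, and the three letters then multiply to
    \<open>Delta\<close>.\<close>
  have "Delta powi (- 1) * (xgen (flip i) * (xgen i * xgen (flip i))) = 1"
    using Delta_eq[of "flip i"] Delta_powi_pred[of 0] by simp
  then show "xgen i * (Delta powi (- 1) * (xgen i * xgen (flip i))) = 1"
    unfolding xgen_Delta_powi_mult by (simp add: twist_def)
qed

text \<open>Existence of normal forms: each clause of \<open>act\<close> mirrors an identity in the
  group. Uniqueness is \<open>nf_normal\<close>.\<close>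

lemma braid3_nf: "V = Delta powi (fst (nf V)) * eval_word (snd (nf V))"
proof (induction V rule: braid3_induct)
  case (gen i V)
  obtain r w where p: "nf V = (r, w)" by (cases "nf V")
  have V: "V = Delta powi r * eval_word w" using gen p by simp
  have "aba_free w" using aba_free_nf[of V] p by simp
  then show ?case
  proof (cases rule: aba_free_Cons_cases[of w "twist r i"])
    case 1
    then show ?thesis
      by (simp add: nf_xgen p) (simp add: V xgen_Delta_powi_mult)
  next
    case (2 w')
    have "xgen j * (xgen (flip j) * (xgen j * X)) = Delta * X" for j X
      by (simp add: Delta_eq[of j] mult.assoc)
    then have "xgen i * V = Delta powi r * (Delta * eval_word w')"
      using 2 by (simp add: V xgen_Delta_powi_mult)
    moreover have "Delta powi (r + 1) = Delta powi r * Delta"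
      using Delta_powi_add[of r 1] by (simp add: power_int_def)
    moreover have "nf (xgen i * V) = (r + 1, w')"
      using 2 by (simp add: nf_xgen p)
    ultimately show ?thesis
      by (metis fst_conv snd_conv mult.assoc)
  qed
next
  case (inverse_gen i V)
  obtain r w where p: "nf V = (r, w)" by (cases "nf V")
  have V: "V = Delta powi r * eval_word w" using inverse_gen p by simp
  have *: "inverse (xgen i) * Delta powi r = Delta powi r * inverse (xgen (twist r i))"
    by (metis braid3_left_inverse' braid3_right_inverse mult.assoc mult_1_right xgen_mult_Delta_powi)
  have V': "inverse (xgen i) * V = Delta powi r * (inverse (xgen (twist r i)) * eval_word w)"
    by (metis V * mult.assoc)
  show ?case
  proof (cases "w \<noteq> [] \<and> hd w = twist r i")
    case True
    then have "w = twist r i # tl w" by (metis list.collapse)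
    then have "inverse (xgen i) * V = Delta powi r * eval_word (tl w)"
      by (metis V' braid3_left_inverse' eval_word_simps(2))
    moreover have "nf (inverse (xgen i) * V) = (r, tl w)"
      using True by (simp add: nf_inverse_xgen p)
    ultimately show ?thesis
      by (metis fst_conv snd_conv)
  next
    case False
    have "Delta powi (r - 1) = Delta powi r * Delta powi (- 1)"
      using Delta_powi_add[of r "- 1"] by simp
    then have "inverse (xgen i) * V =
        Delta powi (r - 1) * eval_word (twist r i # flip (twist r i) # w)"
      using V' by (simp only: inverse_xgen mult.assoc eval_word_simps)
    moreover have "nf (inverse (xgen i) * V) = (r - 1, twist r i # flip (twist r i) # w)"
      using False by (auto simp: nf_inverse_xgen p)
    ultimately show ?thesis
      by (metis fst_conv snd_conv)
  qed
qed simp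

lemma nf_normal: "aba_free w \<Longrightarrow> nf (Delta powi r * eval_word w) = (r, w)"
  by (simp add: nf_Delta_powi nf_eval_word)

section \<open>The positive monoid\<close>

lemma eval_word_inject:
  "aba_free u \<Longrightarrow> aba_free v \<Longrightarrow> eval_word u = eval_word v \<longleftrightarrow> u = v"
  by (metis nf_eval_word prod.inject)

lemma MB3_eq: "MB3 = range eval_word"
proof
  show "MB3 \<subseteq> range eval_word"
  proof
    fix W assume "W \<in> MB3"
    then show "W \<in> range eval_word"
    proof (induction rule: MB3.induct)
      case one
      then show ?case by (metis eval_word_simps(1) rangeI)
    next
      case (step W i)
      then show ?case by (metis eval_word_simps(2) imageE rangeI)
    qed
  qed
  have "eval_word w \<in> MB3" for w
    by (induction w) (auto intro: MB3.intros)
  then show "range eval_word \<subseteq> MB3" by blast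
qed

lemma Delta_power_mult_mem_MB3: "W \<in> MB3 \<Longrightarrow> Delta ^ n * W \<in> MB3"
  by (induction n) (auto simp: Delta_def mult.assoc intro: MB3.intros)

text \<open>Left multiples of \<open>Delta\<close> in the monoid have positive exponent, whereas an
  \<open>aba_free\<close> word has exponent 0. Conversely a positive exponent lets
  \<open>Delta\<close> be split off.\<close>

lemma eval_word_mem_MB3_plus_iff: "eval_word w \<in> MB3_plus \<longleftrightarrow> aba_free w"
proof
  assume w: "aba_free w"
  have "eval_word w \<noteq> Delta * M" if "M \<in> MB3" for M
  proof -
    obtain m where "M = eval_word m" using \<open>M \<in> MB3\<close> MB3_eq by auto
    then have "fst (nf (Delta * M)) > 0"
      using fst_nf_eval_word_nonneg[of m] by (simp add: nf_Delta)
    then show ?thesis using nf_eval_word[OF w] by auto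
  qed
  then show "eval_word w \<in> MB3_plus"
    by (auto simp: MB3_plus_def MB3_eq)
next
  assume w: "eval_word w \<in> MB3_plus"
  show "aba_free w"
  proof (rule ccontr)
    assume "\<not> aba_free w"
    then have pos: "fst (nf (eval_word w)) > 0" by (rule fst_nf_eval_word_pos)
    \<comment> \<open>The exponent minus the one \<open>Delta\<close> split off; it is nonnegative,
      so the cofactor remains in \<open>MB3\<close>.\<close>
    define n where "n = nat (fst (nf (eval_word w)) - 1)"
    have "fst (nf (eval_word w)) = int (Suc n)"
      using pos by (simp add: n_def)
    then have "eval_word w = Delta * (Delta ^ n * eval_word (snd (nf (eval_word w))))"
      using braid3_nf[of "eval_word w"] by (simp add: power_int_def nat_add_distrib mult.assoc)
    then have "eval_word w \<in> (*) Delta ` MB3"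
      using Delta_power_mult_mem_MB3[of _ n] MB3_eq by blast
    then show False using w by (simp add: MB3_plus_def)
  qed
qed

lemma MB3_plus_eq: "MB3_plus = eval_word ` {w. aba_free w}"
proof -
  have "MB3_plus \<subseteq> range eval_word"
    using MB3_eq by (auto simp: MB3_plus_def)
  then show ?thesis
    using eval_word_mem_MB3_plus_iff by blast
qed

section \<open>Canonical length\<close>

definition simple_words :: "gen_idx list set" where
  "simple_words = range (\<lambda>i. [i]) \<union> range (\<lambda>i. [i, flip i])"

lemma eval_word_simple_words: "eval_word ` simple_words = Div - {1, Delta}"
proof
  have gen_idx: "i = I1 \<or> i = I2" for i by (cases i) auto
  have "nf Delta = (1, [])" using nf_Delta[of 1] by simp
  moreover have "nf (eval_word b) = (0, b)" "b \<noteq> []" if "b \<in> simple_words" for b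
    using that by (auto simp: simple_words_def intro!: nf_eval_word)
  ultimately have "eval_word b \<noteq> 1 \<and> eval_word b \<noteq> Delta" if "b \<in> simple_words" for b
    using that by (metis nf_1 prod.inject zero_neq_one)
  moreover have "eval_word b \<in> Div" if "b \<in> simple_words" for b
    using that gen_idx by (auto simp: simple_words_def Div_def) (metis flip.simps)+
  ultimately show "eval_word ` simple_words \<subseteq> Div - {1, Delta}" by auto
  have "[i] \<in> simple_words" "[i, flip i] \<in> simple_words" for i
    by (auto simp: simple_words_def)
  from this(1)[of I1] this(1)[of I2] this(2)[of I1] this(2)[of I2]
  have "eval_word [I1] \<in> eval_word ` simple_words" "eval_word [I2] \<in> eval_word ` simple_words"
    "eval_word [I1, I2] \<in> eval_word ` simple_words" "eval_word [I2, I1] \<in> eval_word ` simple_words"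
    by (simp_all only: flip.simps imageI)
  then show "Div - {1, Delta} \<subseteq> eval_word ` simple_words"
    by (auto simp: Div_def)
qed

lemma simple_words_props:
  assumes "b \<in> simple_words"
  shows "b \<noteq> []" "aba_free b" "changes b + 1 = length b"
  using assms by (auto simp: simple_words_def)

text \<open>An element of \<open>MB3_plus\<close> is spelled by only one positive word, so
  divisibility by a generator on either side can be read off the end letters.\<close>

lemma left_weighted_iff:
  assumes "aba_free u" "aba_free v" "u \<noteq> []" "v \<noteq> []"
  shows "(\<forall>k. \<forall>B \<in> MB3_plus. eval_word v = xgen k * B \<longrightarrow>
            (\<exists>C \<in> MB3_plus. eval_word u = C * xgen k)) \<longleftrightarrow> last u = hd v" (is "?L \<longleftrightarrow> ?R")
proof
  assume ?L
  obtain k b where v: "v = k # b" using assms(4) by (cases v) auto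
  then have "eval_word b \<in> MB3_plus"
    using assms(2) by (metis aba_free_ConsD eval_word_mem_MB3_plus_iff)
  then have "\<exists>C \<in> MB3_plus. eval_word u = C * xgen k"
    using \<open>?L\<close> v by simp
  then obtain c where c: "eval_word u = eval_word (c @ [k])"
    by (auto simp: MB3_plus_eq)
  then have "aba_free (c @ [k])"
    using assms(1) eval_word_mem_MB3_plus_iff by metis
  then have "u = c @ [k]" using c assms(1) by (metis eval_word_inject)
  then show ?R using v by simp
next
  assume R: ?R
  show ?L
  proof (intro allI ballI impI)
    fix k B assume "B \<in> MB3_plus" and eq: "eval_word v = xgen k * B"
    then obtain b where B: "B = eval_word b" by (auto simp: MB3_plus_eq)
    then have "eval_word v = eval_word (k # b)" using eq by simp
    moreover from this have "aba_free (k # b)"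
      using assms(2) eval_word_mem_MB3_plus_iff by metis
    ultimately have "v = k # b" using assms(2) by (metis eval_word_inject)
    then have u: "u = butlast u @ [k]"
      using R assms(3) by (metis append_butlast_last_id list.sel(1))
    then have "eval_word u = eval_word (butlast u) * xgen k"
      by (metis eval_word_simps mult_1_right)
    moreover have "eval_word (butlast u) \<in> MB3_plus"
      using u assms(1) aba_free_appendD1 eval_word_mem_MB3_plus_iff by metis
    ultimately show "\<exists>C \<in> MB3_plus. eval_word u = C * xgen k" by blast
  qed
qed

lemma prod_list_map_eval_word: "prod_list (map eval_word bs) = eval_word (concat bs)"
  by (induction bs) auto

lemma left_canonical_form_iff:
  assumes "set bs \<subseteq> simple_words"
  shows "left_canonical_form V r (map eval_word bs) \<longleftrightarrow>
    V = Delta powi r * eval_word (concat bs) \<and> aba_free (concat bs) \<and>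
    successively (\<lambda>u v. last u = hd v) bs"
proof -
  have "bs ! j \<in> simple_words" if "j < length bs" for j
    using that assms nth_mem by blast
  then have b: "bs ! j \<noteq> []" "aba_free (bs ! j)" if "j < length bs" for j
    using that simple_words_props by simp_all
  have "set (map eval_word bs) \<subseteq> Div - {1, Delta}"
    using assms eval_word_simple_words by auto
  then show ?thesis
    unfolding left_canonical_form_def prod_list_map_eval_word eval_word_mem_MB3_plus_iff
      successively_conv_nth
    using left_weighted_iff b by (simp cong: imp_cong)
qed

text \<open>Each block has one change fewer than letters, and the junctions contribute none because
  the letters there agree.\<close>

lemma changes_concat_simple:
  assumes "set bs \<subseteq> simple_words" "successively (\<lambda>u v. last u = hd v) bs"
  shows "changes (concat bs) + length bs = length (concat bs)"
  using assms
proof (induction bs)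
  case (Cons b bs)
  have b: "b \<noteq> []" "changes b + 1 = length b"
    using Cons.prems simple_words_props by auto
  show ?case
  proof (cases bs)
    case Nil
    then show ?thesis using b by simp
  next
    case (Cons b' bs')
    then have "b' \<noteq> []" "last b = hd b'"
      using Cons.prems simple_words_props by auto
    then have "changes (concat (b # bs)) = changes b + changes (concat bs)"
      using b Cons by (simp add: changes_append)
    then show ?thesis
      using b Cons.IH Cons.prems Cons by auto
  qed
qed simp

text \<open>Greedy reading from the left: two different neighbours are taken together, otherwise a
  single letter is taken.\<close>

fun simple_blocks :: "gen_idx list \<Rightarrow> gen_idx list list" where
  "simple_blocks (a # b # w) =
     (if a = b then [a] # simple_blocks (b # w) else [a, b] # simple_blocks w)"
| "simple_blocks [a] = [[a]]"
| "simple_blocks [] = []"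

lemma concat_simple_blocks [simp]: "concat (simple_blocks w) = w"
  by (induction w rule: simple_blocks.induct) auto

lemma simple_blocks_eq_Nil_iff [simp]: "simple_blocks w = [] \<longleftrightarrow> w = []"
  by (cases w rule: simple_blocks.cases) auto

lemma hd_hd_simple_blocks: "w \<noteq> [] \<Longrightarrow> hd (hd (simple_blocks w)) = hd w"
  by (cases w rule: simple_blocks.cases) auto

lemma set_simple_blocks: "set (simple_blocks w) \<subseteq> simple_words"
proof (induction w rule: simple_blocks.induct)
  case (1 a b w)
  then show ?case using neq_imp_flip[of a b] by (cases "a = b") (auto simp: simple_words_def)
qed (auto simp: simple_words_def)

text \<open>After a block \<open>[a, b]\<close> with \<open>a \<noteq> b\<close> the next letter
  cannot be \<open>a\<close>, as this would complete an \<open>aba\<close>; so it repeats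
  \<open>b\<close>. A block \<open>[a]\<close> is only formed before another \<open>a\<close> or at
  the end.\<close>

lemma successively_simple_blocks:
  "aba_free w \<Longrightarrow> successively (\<lambda>u v. last u = hd v) (simple_blocks w)"
proof (induction w rule: simple_blocks.induct)
  case (1 a b w)
  have "aba_free (b # w)"
    using aba_free_ConsD[OF "1.prems"] .
  moreover from this have "aba_free w"
    by (rule aba_free_ConsD)
  moreover have "w = [] \<or> a = b \<or> hd w = b"
  proof (cases w)
    case (Cons c w')
    then have "a = b \<or> a \<noteq> c" using 1 by simp
    then show ?thesis using Cons neq_imp_flip by (metis list.sel(1))
  qed simp
  ultimately show ?case
    using "1.IH" by (cases "w = []"; cases "a = b") (simp_all add: successively_Cons hd_hd_simple_blocks)
qed auto

text \<open>\<open>simple_blocks\<close> provides one form. Any other concatenates to the same word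
  by uniqueness of normal forms, and counting changes then forces its number of blocks.\<close>

lemma canonical_length_normal:
  assumes "aba_free w"
  shows "canonical_length (Delta powi r * eval_word w) = length w - changes w"
  unfolding canonical_length_def
proof (rule the_equality)
  show "\<exists>r' As. left_canonical_form (Delta powi r * eval_word w) r' As \<and>
      length w - changes w = length As"
  proof (intro exI conjI)
    show "left_canonical_form (Delta powi r * eval_word w) r (map eval_word (simple_blocks w))"
      using assms by (simp add: left_canonical_form_iff set_simple_blocks successively_simple_blocks)
    show "length w - changes w = length (map eval_word (simple_blocks w))"
      using changes_concat_simple[OF set_simple_blocks successively_simple_blocks[OF assms]] by simp
  qed
next
  fix q assume "\<exists>r' As. left_canonical_form (Delta powi r * eval_word w) r' As \<and> q = length As"
  then obtain r' As where As: "left_canonical_form (Delta powi r * eval_word w) r' As" "q = length As"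
    by blast
  then have "set As \<subseteq> eval_word ` simple_words"
    by (simp add: left_canonical_form_def eval_word_simple_words)
  then have "As \<in> lists (eval_word ` simple_words)"
    by auto
  then obtain bs where bs: "As = map eval_word bs" "set bs \<subseteq> simple_words"
    unfolding lists_image by auto
  then have c: "Delta powi r * eval_word w = Delta powi r' * eval_word (concat bs)"
      "aba_free (concat bs)" "successively (\<lambda>u v. last u = hd v) bs"
    using As(1) left_canonical_form_iff[OF bs(2)] unfolding bs(1) by simp_all
  then have "concat bs = w"
    using nf_normal assms by (metis prod.inject)
  then show "q = length w - changes w"
    using changes_concat_simple[OF bs(2) c(3)] As(2) bs(1) by simp
qed

section \<open>Conjugation\<close>

text \<open>The homomorphism to the integers with value 1 on both generators. Its invariance under
  conjugation bounds the exponents in a class and fixes the word length at a given exponent.\<close>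

lift_definition exponent_sum :: "braid3 \<Rightarrow> int" is
  "\<lambda>u. sum_list (map (\<lambda>(i, e). if e then 1 else - 1) u)"
proof -
  fix u v assume "braid_eq u v"
  then show "sum_list (map (\<lambda>(i, e). if e then 1 else - 1) u) =
      (sum_list (map (\<lambda>(i, e). if e then 1 else - 1) v) :: int)"
    by (induction rule: braid_eq.induct) auto
qed

lemma exponent_sum_mult [simp]: "exponent_sum (a * b) = exponent_sum a + exponent_sum b"
  by transfer simp

lemma exponent_sum_1 [simp]: "exponent_sum 1 = 0"
  by transfer simp

lemma exponent_sum_xgen [simp]: "exponent_sum (xgen i) = 1"
  by transfer simp

lemma exponent_sum_inverse [simp]: "exponent_sum (inverse a) = - exponent_sum a"
  using exponent_sum_mult[of "inverse a" a] by simp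

lemma exponent_sum_eval_word [simp]: "exponent_sum (eval_word w) = int (length w)"
  by (induction w) auto

lemma exponent_sum_Delta [simp]: "exponent_sum Delta = 3"
  by (simp add: Delta_def)

lemma exponent_sum_Delta_powi [simp]: "exponent_sum (Delta powi r) = 3 * r"
proof (induction r rule: int_induct[where k = 0])
  case (step1 r)
  then show ?case by (simp add: Delta_powi_Suc)
next
  case (step2 r)
  then show ?case by (simp add: Delta_powi_pred)
qed simp

lemma conj_class_iff: "U \<in> conj_class V \<longleftrightarrow> (\<exists>g. U = g * V * inverse g)"
  by (auto simp: conj_class_def)

lemma self_mem_conj_class: "V \<in> conj_class V"
  unfolding conj_class_iff by (rule exI[of _ 1]) (simp add: braid3_inverse_unique)

lemma exponent_sum_conj_class: "U \<in> conj_class V \<Longrightarrow> exponent_sum U = exponent_sum V"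
  by (auto simp: conj_class_iff)

lemma power_conj: "(g * V * inverse g) ^ n = g * V ^ n * inverse (g :: braid3)"
  by (induction n) (simp_all add: mult.assoc)

text \<open>Conjugation by the suffix \<open>v\<close> brings it to the front, and passing
  \<open>Delta powi r\<close> twists it.\<close>

lemma rotation_mem_conj_class:
  "Delta powi r * eval_word (map (twist r) v @ u) \<in> conj_class (Delta powi r * eval_word (u @ v))"
proof -
  have "eval_word v * (Delta powi r * eval_word (u @ v)) * inverse (eval_word v) =
      eval_word v * Delta powi r * eval_word u"
    by (simp add: mult.assoc)
  also have "\<dots> = Delta powi r * eval_word (map (twist r) v @ u)"
    by (simp add: eval_word_mult_Delta_powi mult.assoc)
  finally show ?thesis
    unfolding conj_class_iff by metis
qed

text \<open>An anti-automorphism, since the relations are symmetric under reversal. It carries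
  estimates for left multiplication over to right multiplication.\<close>

lift_definition reverse :: "braid3 \<Rightarrow> braid3" is rev
proof -
  fix u v assume "braid_eq u v"
  then show "braid_eq (rev u) (rev v)"
  proof (induction rule: braid_eq.induct)
    case (cancel i e)
    then show ?case using braid_eq.cancel[of i "\<not> e"] by simp
  qed (auto intro: braid_eq.intros)
qed

lemma reverse_mult: "reverse (a * b) = reverse b * reverse a"
  by transfer (simp add: braid_eq.refl)

lemma reverse_1 [simp]: "reverse 1 = 1"
  by transfer (simp add: braid_eq.refl)

lemma reverse_xgen [simp]: "reverse (xgen i) = xgen i"
  by transfer (simp add: braid_eq.refl)

lemma reverse_reverse [simp]: "reverse (reverse a) = a"
  by transfer (simp add: braid_eq.refl)

lemma reverse_inverse: "reverse (inverse a) = inverse (reverse a)"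
proof -
  have "reverse a * reverse (inverse a) = 1"
    by (simp flip: reverse_mult)
  then show ?thesis by (simp add: braid3_inverse_unique)
qed

lemma reverse_Delta [simp]: "reverse Delta = Delta"
  by (simp add: Delta_def reverse_mult mult.assoc)

lemma reverse_power: "reverse (a ^ n) = reverse a ^ n"
  by (induction n) (simp_all add: reverse_mult power_commutes)

lemma reverse_Delta_powi [simp]: "reverse (Delta powi r) = Delta powi r"
  by (simp add: power_int_def reverse_power reverse_inverse)

lemma reverse_eval_word: "reverse (eval_word w) = eval_word (rev w)"
  by (induction w) (simp_all add: reverse_mult)

section \<open>Letter changes under multiplication and conjugation\<close>

definition nf_changes :: "braid3 \<Rightarrow> int" where
  "nf_changes V = int (changes (snd (nf V)))"

lemma nf_changes_reverse [simp]: "nf_changes (reverse V) = nf_changes V"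
proof -
  obtain r w where p: "nf V = (r, w)" by (cases "nf V")
  have "aba_free w" using aba_free_nf[of V] p by simp
  have "V = Delta powi r * eval_word w"
    using braid3_nf[of V] p by simp
  then have "reverse V = Delta powi r * eval_word (map (twist r) (rev w))"
    by (simp add: reverse_mult reverse_eval_word eval_word_mult_Delta_powi)
  then have "nf (reverse V) = (r, map (twist r) (rev w))"
    using \<open>aba_free w\<close> by (simp add: nf_normal)
  then show ?thesis
    by (simp add: nf_changes_def p)
qed

lemma changes_Cons_bounds: "changes w \<le> changes (a # w) \<and> changes (a # w) \<le> changes w + 1"
  by (cases w) simp_all

text \<open>When two letters are added or dropped at the front, the second of them equals the letter
  that follows, if any, so just one change is involved.\<close>

lemma changes_act_bound:
  assumes "aba_free (snd p)"
  shows "\<bar>int (changes (snd (act l p))) - int (changes (snd p))\<bar> \<le> 1"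
proof -
  obtain i e r w where [simp]: "l = (i, e)" "p = (r, w)"
    by (metis surj_pair)
  have w: "aba_free w" using assms by simp
  define j where "j = twist r i"
  show ?thesis
  proof (cases e)
    case True
    from w show ?thesis
    proof (cases rule: aba_free_Cons_cases[of w j])
      case 1
      then show ?thesis using True changes_Cons_bounds[of w j] by (simp flip: j_def)
    next
      case (2 w')
      then have "changes w = changes w' + 1" by (cases w') auto
      then show ?thesis using 2 True by (simp flip: j_def)
    qed
  next
    case False
    show ?thesis
    proof (cases "w \<noteq> [] \<and> hd w = j")
      case True
      then show ?thesis
        using False changes_Cons_bounds[of "tl w" "hd w"] by (cases w) (auto simp flip: j_def)
    next
      case ninit: False
      then have "changes (j # flip j # w) = changes w + 1"
        by (cases w) (auto dest: neq_imp_flip)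
      then show ?thesis using False ninit by (auto simp flip: j_def)
    qed
  qed
qed

text \<open>Each letter of a signed word for \<open>g\<close> costs at most one, so the bound
  depends on \<open>g\<close> and not on \<open>V\<close>.\<close>

lemma nf_changes_mult_left_bound: "\<exists>m. \<forall>V. \<bar>nf_changes (g * V) - nf_changes V\<bar> \<le> m"
proof (induction g rule: braid3_induct)
  case one
  then show ?case by (intro exI[of _ 0]) simp
next
  case (gen i g)
  then obtain m where m: "\<And>V. \<bar>nf_changes (g * V) - nf_changes V\<bar> \<le> m" by blast
  have "\<bar>nf_changes (xgen i * g * V) - nf_changes V\<bar> \<le> m + 1" for V
    using m[of V] changes_act_bound[of "nf (g * V)" "(i, True)"]
    by (simp add: nf_changes_def mult.assoc nf_xgen del: act.simps)
  then show ?case by blast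
next
  case (inverse_gen i g)
  then obtain m where m: "\<And>V. \<bar>nf_changes (g * V) - nf_changes V\<bar> \<le> m" by blast
  have "\<bar>nf_changes (inverse (xgen i) * g * V) - nf_changes V\<bar> \<le> m + 1" for V
    using m[of V] changes_act_bound[of "nf (g * V)" "(i, False)"]
    by (simp add: nf_changes_def mult.assoc nf_inverse_xgen del: act.simps)
  then show ?case by blast
qed

lemma nf_changes_conj_bound:
  "\<exists>m. \<forall>V. \<bar>nf_changes (g * V * inverse g) - nf_changes V\<bar> \<le> m"
proof -
  obtain m where m: "\<And>V. \<bar>nf_changes (g * V) - nf_changes V\<bar> \<le> m"
    using nf_changes_mult_left_bound by blast
  \<comment> \<open>Under \<open>reverse\<close>, right multiplication by \<open>inverse g\<close>
    becomes left multiplication, and \<open>nf_changes\<close> is preserved.\<close>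
  obtain m' where m': "\<And>V. \<bar>nf_changes (reverse (inverse g) * V) - nf_changes V\<bar> \<le> m'"
    using nf_changes_mult_left_bound by blast
  have "\<bar>nf_changes (V * inverse g) - nf_changes V\<bar> \<le> m'" for V
    using m'[of "reverse V"] by (simp flip: reverse_mult)
  then have "\<bar>nf_changes (g * V * inverse g) - nf_changes V\<bar> \<le> m + m'" for V
    using m[of "V * inverse g"] by (smt (verit) mult.assoc)
  then show ?thesis by blast
qed

text \<open>The positive part of a power of \<open>Delta powi r * eval_word w\<close> once all
  \<open>Delta\<close> are collected on the left: a copy of \<open>w\<close> followed by
  \<open>j\<close> further copies is twisted by \<open>j * r\<close>.\<close>

fun power_word :: "int \<Rightarrow> gen_idx list \<Rightarrow> nat \<Rightarrow> gen_idx list" where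
  "power_word r w 0 = []"
| "power_word r w (Suc k) = map (twist (int k * r)) w @ power_word r w k"

lemma normal_power:
  "(Delta powi r * eval_word w) ^ k = Delta powi (int k * r) * eval_word (power_word r w k)"
proof (induction k)
  case (Suc k)
  have "(Delta powi r * eval_word w) ^ Suc k =
      Delta powi r * (eval_word w * Delta powi (int k * r)) * eval_word (power_word r w k)"
    by (simp add: Suc.IH mult.assoc)
  also have "\<dots> = Delta powi (r + int k * r) * eval_word (power_word r w (Suc k))"
    by (simp add: eval_word_mult_Delta_powi Delta_powi_add mult.assoc)
  finally show ?case by (simp add: algebra_simps)
qed simp

text \<open>Two neighbouring copies form a twist of \<open>map (twist r) w @ w\<close>; such pairs
  overlap in a whole copy, which is long enough for gluing.\<close>

lemma aba_free_power_word:
  assumes "aba_free (map (twist r) w @ w)" "length w \<ge> 2"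
  shows "aba_free (power_word r w k)"
proof (induction k)
  case (Suc k)
  show ?case
  proof (cases k)
    case 0
    then show ?thesis using assms(1) aba_free_appendD2 by auto
  next
    case l: (Suc l)
    have "map (twist (int k * r)) w @ map (twist (int l * r)) w =
        map (twist (int l * r)) (map (twist r) w @ w)"
      by (simp add: l algebra_simps)
    then have "aba_free (map (twist (int k * r)) w @ map (twist (int l * r)) w)"
      using assms(1) by (simp only: aba_free_map_twist)
    then have "aba_free (map (twist (int k * r)) w @ map (twist (int l * r)) w @ power_word r w l)"
      using Suc l assms(2) by (intro aba_free_glue) auto
    then show ?thesis by (simp add: l)
  qed
qed simp

text \<open>The added term is the junction between consecutive copies in \<open>power_word\<close>,
  where the left copy carries one more twist by \<open>r\<close>.\<close>

definition cyclic_changes :: "int \<Rightarrow> gen_idx list \<Rightarrow> nat" where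
  "cyclic_changes r w = changes w + (if twist r (last w) = hd w then 0 else 1)"

text \<open>Every copy after the first brings its own changes and one junction. The term added on
  the left avoids subtraction of naturals.\<close>

lemma changes_power_word:
  assumes "w \<noteq> []"
  shows "changes (power_word r w (Suc k)) + cyclic_changes r w = changes w + Suc k * cyclic_changes r w"
proof (induction k)
  case (Suc k)
  have "hd (power_word r w (Suc k)) = twist (int k * r) (hd w)"
    using assms by (simp add: hd_append hd_map)
  moreover have "last (map (twist (int (Suc k) * r)) w) = twist (int k * r) (twist r (last w))"
    using assms by (simp add: last_map algebra_simps)
  moreover have "twist (int k * r) (twist r (last w)) = twist (int k * r) (hd w) \<longleftrightarrow> twist r (last w) = hd w"
    by (rule twist_inject)
  ultimately have "changes (power_word r w (Suc (Suc k))) =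
      cyclic_changes r w + changes (power_word r w (Suc k))"
    using assms changes_append[of "map (twist (int (Suc k) * r)) w" "power_word r w (Suc k)"]
    by (simp add: cyclic_changes_def del: twist_twist)
  then show ?case using Suc by simp
qed simp

text \<open>The letter changes of the normal forms of \<open>V ^ k\<close> grow like \<open>k\<close> times the cyclic changes
  of \<open>V\<close>, and conjugation disturbs them by a bounded amount only.\<close>

lemma cyclic_changes_conj_class:
  assumes "Delta powi r * eval_word w \<in> conj_class (Delta powi r' * eval_word w')"
    and "aba_free (map (twist r) w @ w)" "length w \<ge> 2"
    and "aba_free (map (twist r') w' @ w')" "length w' \<ge> 2"
  shows "cyclic_changes r w = cyclic_changes r' w'"
proof (rule ccontr)
  assume neq: "cyclic_changes r w \<noteq> cyclic_changes r' w'"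
  obtain g where g: "Delta powi r * eval_word w = g * (Delta powi r' * eval_word w') * inverse g"
    using assms(1) unfolding conj_class_iff by blast
  obtain m where m: "\<And>V. \<bar>nf_changes (g * V * inverse g) - nf_changes V\<bar> \<le> m"
    using nf_changes_conj_bound by blast
  have nfc: "nf_changes ((Delta powi r * eval_word w) ^ Suc k) =
      int (changes w) + int k * int (cyclic_changes r w)"
    if "aba_free (map (twist r) w @ w)" "length w \<ge> 2" for r w k
  proof -
    have "w \<noteq> []" using that by auto
    then have "changes (power_word r w (Suc k)) = changes w + k * cyclic_changes r w"
      using changes_power_word[of w r k] by simp
    then show ?thesis
      using aba_free_power_word[OF that, of "Suc k"]
      by (simp only: normal_power nf_changes_def nf_normal snd_conv of_nat_add of_nat_mult)
  qed
  define d where "d = int (cyclic_changes r w) - int (cyclic_changes r' w')"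
  define e where "e = int (changes w) - int (changes w')"
  have "\<bar>e + int k * d\<bar> \<le> m" for k
  proof -
    have "\<bar>nf_changes ((Delta powi r * eval_word w) ^ Suc k) -
        nf_changes ((Delta powi r' * eval_word w') ^ Suc k)\<bar> \<le> m"
      using m[of "(Delta powi r' * eval_word w') ^ Suc k"] unfolding g power_conj .
    then show ?thesis
      unfolding nfc[OF assms(2,3)] nfc[OF assms(4,5)] by (simp add: d_def e_def algebra_simps)
  qed
  note bound = this
  \<comment> \<open>Chosen so large that a nonzero \<open>d\<close> forces
    \<open>\<bar>e + K * d\<bar>\<close> above \<open>m\<close>.\<close>
  define K where "K = m + \<bar>e\<bar> + 1"
  have "m \<ge> 0" using bound[of 0] by simp
  then have "\<bar>e + K * d\<bar> \<le> m" using bound[of "nat K"] by (simp add: K_def)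
  moreover have "K * 1 \<le> \<bar>K\<bar> * \<bar>d\<bar>"
    using neq \<open>m \<ge> 0\<close> by (intro mult_mono) (auto simp: d_def K_def)
  then have "K \<le> \<bar>K * d\<bar>"
    by (simp only: abs_mult mult_1_right)
  ultimately show False
    using K_def by linarith
qed

section \<open>Summit sets\<close>

text \<open>\<open>GREATEST\<close> is meaningful here because positive words have nonnegative
  exponent sum: this sum, constant on the class, bounds \<open>3 * r\<close> from above.\<close>

lemma exp_class_greatest:
  defines "P \<equiv> \<lambda>V r. \<exists>W \<in> MB3_plus. Delta powi r * W \<in> conj_class V"
  shows "P V (exp_class (conj_class V))"
    and "P V r \<Longrightarrow> r \<le> exp_class (conj_class V)"
proof -
  have bound: "3 * r \<le> exponent_sum V" if "P V r" for r
  proof -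
    from that obtain w where "Delta powi r * eval_word w \<in> conj_class V"
      by (auto simp: P_def MB3_plus_eq)
    then show ?thesis by (auto dest!: exponent_sum_conj_class)
  qed
  \<comment> \<open>An exponent known to occur; discarding those below it makes the set finite
    without affecting its maximum.\<close>
  define r0 where "r0 = fst (nf V)"
  define R where "R = {r. P V r \<and> r0 \<le> r}"
  have "eval_word (snd (nf V)) \<in> MB3_plus"
    by (simp add: eval_word_mem_MB3_plus_iff)
  moreover have "Delta powi r0 * eval_word (snd (nf V)) \<in> conj_class V"
    using self_mem_conj_class[of V] unfolding r0_def by (simp flip: braid3_nf)
  ultimately have "r0 \<in> R"
    by (auto simp: R_def P_def)
  \<comment> \<open>From \<open>3 * r \<le> exponent_sum V\<close>, with \<open>2 * r\<close>
    bounded below by \<open>2 * r0\<close>.\<close>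
  moreover have "R \<subseteq> {r0..exponent_sum V - 2 * r0}"
    using bound by (force simp: R_def)
  then have "finite R"
    by (rule finite_subset) simp
  ultimately have "Max R \<in> R"
    using Max_in by blast
  have Max: "s \<le> Max R" if "P V s" for s
  proof (cases "r0 \<le> s")
    case True
    then show ?thesis using that \<open>finite R\<close> by (simp add: R_def)
  next
    case False
    then show ?thesis using Max_ge[OF \<open>finite R\<close> \<open>r0 \<in> R\<close>] by simp
  qed
  have "exp_class (conj_class V) = (GREATEST r. P V r)"
    by (simp add: exp_class_def P_def)
  also have "\<dots> = Max R"
    using \<open>Max R \<in> R\<close> Max by (intro Greatest_equality) (auto simp: R_def)
  finally show "P V (exp_class (conj_class V))" "P V r \<Longrightarrow> r \<le> exp_class (conj_class V)"
    using \<open>Max R \<in> R\<close> Max by (simp_all add: R_def)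
qed

lemma summit_word_eval_word_iff:
  assumes "aba_free w"
  shows "summit_word r (eval_word w) \<longleftrightarrow> r = exp_class (conj_class (Delta powi r * eval_word w))"
proof
  assume "summit_word r (eval_word w)"
  then obtain w' where "aba_free w'" "Delta powi r * eval_word w =
      Delta powi (exp_class (conj_class (Delta powi r * eval_word w))) * eval_word w'"
    by (auto simp: summit_word_def SS_def MB3_plus_eq)
  then show "r = exp_class (conj_class (Delta powi r * eval_word w))"
    using assms nf_normal by (metis prod.inject)
next
  assume r: "r = exp_class (conj_class (Delta powi r * eval_word w))"
  then show "summit_word r (eval_word w)"
    using assms self_mem_conj_class unfolding summit_word_def SS_def
    by (auto simp: eval_word_mem_MB3_plus_iff)
qed

text \<open>A factor \<open>aba\<close> would release another \<open>Delta\<close> and push the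
  exponent beyond the maximum of the class.\<close>

lemma summit_word_conj_aba_free:
  assumes "aba_free w" "summit_word r (eval_word w)"
    and "Delta powi r * eval_word w' \<in> conj_class (Delta powi r * eval_word w)"
  shows "aba_free w'"
proof (rule ccontr)
  assume "\<not> aba_free w'"
  define s where "s = fst (nf (eval_word w'))"
  define w'' where "w'' = snd (nf (eval_word w'))"
  have "s > 0" using fst_nf_eval_word_pos[OF \<open>\<not> aba_free w'\<close>] by (simp add: s_def)
  have "Delta powi r * eval_word w' = Delta powi (r + s) * eval_word w''"
    using braid3_nf[of "eval_word w'"] by (simp add: s_def w''_def Delta_powi_add mult.assoc)
  moreover have "eval_word w'' \<in> MB3_plus"
    by (simp add: w''_def eval_word_mem_MB3_plus_iff)
  ultimately have "r + s \<le> exp_class (conj_class (Delta powi r * eval_word w))"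
    using exp_class_greatest(2) assms(3) by metis
  then show False
    using \<open>s > 0\<close> assms summit_word_eval_word_iff by simp
qed

lemma SS_summit:
  assumes "aba_free w" "summit_word r (eval_word w)"
  shows "SS (conj_class (Delta powi r * eval_word w)) =
    {Delta powi r * eval_word w' | w'. aba_free w' \<and>
       Delta powi r * eval_word w' \<in> conj_class (Delta powi r * eval_word w)}"
proof -
  have "exp_class (conj_class (Delta powi r * eval_word w)) = r"
    using assms summit_word_eval_word_iff by simp
  then show ?thesis
    by (auto simp: SS_def MB3_plus_eq)
qed

lemma conj_class_length_eq:
  "Delta powi r * eval_word w' \<in> conj_class (Delta powi r * eval_word w) \<Longrightarrow> length w' = length w"
  by (auto dest!: exponent_sum_conj_class)

text \<open>The exponent sum makes all words of the summit set equally long, so minimal canonical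
  length means the most changes.\<close>

lemma super_summit_word_iff:
  assumes "aba_free w" "summit_word r (eval_word w)"
  shows "super_summit_word r (eval_word w) \<longleftrightarrow>
    (\<forall>w'. aba_free w' \<longrightarrow> Delta powi r * eval_word w' \<in> conj_class (Delta powi r * eval_word w) \<longrightarrow>
      changes w' \<le> changes w)"
proof -
  have "length w - changes w \<le> length w' - changes w' \<longleftrightarrow> changes w' \<le> changes w"
    if "Delta powi r * eval_word w' \<in> conj_class (Delta powi r * eval_word w)" for w'
    using conj_class_length_eq[OF that] changes_le_length[of w] changes_le_length[of w'] by linarith
  moreover have "Delta powi r * eval_word w \<in> SS (conj_class (Delta powi r * eval_word w))"
    using assms(2) by (simp add: summit_word_def)
  ultimately show ?thesis
    unfolding super_summit_word_def SSS_def eval_word_mem_MB3_plus_iff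
    using assms canonical_length_normal by (auto simp: SS_summit)
qed

text \<open>From three letters on, each three-letter factor across the junction occurs in a rotation
  of \<open>w\<close>. Two letters are too few for that: \<open>[i, flip i]\<close> with
  \<open>r\<close> even has harmless rotations, yet doubling it creates an
  \<open>aba\<close>.\<close>

lemma aba_free_cyclic:
  assumes rotate: "\<And>u v. w = u @ v \<Longrightarrow> aba_free (map (twist r) v @ u)"
    and "length w \<ge> 2" "\<not> (length w = 2 \<and> even r \<and> changes w = 1)"
  shows "aba_free (map (twist r) w @ w)"
proof -
  obtain u y z where w: "w = u @ [y, z]"
  proof -
    obtain v z where v: "w = v @ [z]"
      using assms(2) by (cases w rule: rev_cases) auto
    then obtain u y where "v = u @ [y]"
      using assms(2) by (cases v rule: rev_cases) auto
    then show ?thesis using that v by simp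
  qed
  show ?thesis
  proof (cases u)
    case Nil
    then show ?thesis
      using w assms(3) neq_imp_flip[of y z] by (auto simp: twist_def split: if_splits)
  next
    case (Cons a u')
    define y' z' where "y' = twist r y" "z' = twist r z"
    \<comment> \<open>The first rotation contains the factor \<open>y' z'\<close> followed by the
      first letter of \<open>w\<close>, the second one \<open>z'\<close> followed by the first two
      letters.\<close>
    have "aba_free (y' # z' # u)" "aba_free ([z'] @ u @ [y])" "aba_free w"
      using rotate[of u "[y, z]"] rotate[of "u @ [y]" "[z]"] rotate[of w "[]"] w
      by (simp_all add: y'_z'_def)
    have "aba_free ([z'] @ (u @ [y]) @ [z])"
      using \<open>aba_free w\<close> \<open>aba_free ([z'] @ u @ [y])\<close> w Cons
      by (intro aba_free_glue[of "[z']" "u @ [y]" "[z]"]) auto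
    then have "aba_free (y' # z' # w)"
      using \<open>aba_free (y' # z' # u)\<close> w Cons by simp
    moreover have "aba_free (map (twist r) u @ [y', z'])"
    proof -
      have "map (twist r) u @ [y', z'] = map (twist r) w" by (simp add: w y'_z'_def)
      then show ?thesis using \<open>aba_free w\<close> by simp
    qed
    ultimately have "aba_free (map (twist r) u @ [y', z'] @ w)"
      by (intro aba_free_glue) auto
    then show ?thesis by (simp add: w y'_z'_def)
  qed
qed

lemma Delta_powi_even_central:
  assumes "even r"
  shows "g * Delta powi r = Delta powi r * g"
proof -
  have "map (twist r) w = w" for w
    using assms by (simp add: twist_def map_idI)
  then have "eval_word w * Delta powi r = Delta powi r * eval_word w" for w
    by (simp add: eval_word_mult_Delta_powi)
  then show ?thesis
    using braid3_nf[of g] Delta_powi_add by (metis add.commute mult.assoc)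
qed

text \<open>Settles the case excluded in \<open>aba_free_cyclic\<close>. The cube of the alternating
  element is an even power of \<open>Delta\<close>, hence central and fixed by conjugation, while
  the cube of the other has six letters in its normal form.\<close>

lemma square_not_conj_alternating:
  assumes "even r"
  shows "Delta powi r * eval_word [i, flip i] \<notin> conj_class (Delta powi r * eval_word [j, j])"
proof
  assume "Delta powi r * eval_word [i, flip i] \<in> conj_class (Delta powi r * eval_word [j, j])"
  then obtain g where g: "Delta powi r * eval_word [i, flip i] =
      g * (Delta powi r * eval_word [j, j]) * inverse g"
    unfolding conj_class_iff by blast
  have even: "twist r a = a" "twist (r * k) a = a" "twist (k * r) a = a" for k a
    using assms by (simp_all add: twist_def)
  have "(Delta powi r * eval_word [i, flip i]) ^ 3 =
      Delta powi (3 * r) * eval_word [i, flip i, i, flip i, i, flip i]"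
    unfolding normal_power by (simp add: numeral_3_eq_3 even)
  moreover have "eval_word [i, flip i, i, flip i, i, flip i] = Delta * Delta"
  proof -
    have "Delta * Delta = (xgen i * (xgen (flip i) * xgen i)) * (xgen (flip i) * (xgen i * xgen (flip i)))"
      by (metis Delta_eq flip_flip)
    then show ?thesis by (simp add: mult.assoc)
  qed
  moreover have "Delta * Delta = Delta powi 2"
    by (simp add: power_int_def power2_eq_square)
  ultimately have "(Delta powi r * eval_word [i, flip i]) ^ 3 = Delta powi (3 * r + 2)"
    by (simp add: Delta_powi_add)
  then have "g * (Delta powi r * eval_word [j, j]) ^ 3 * inverse g = Delta powi (3 * r + 2)"
    unfolding g power_conj .
  then have "g * (Delta powi r * eval_word [j, j]) ^ 3 = Delta powi (3 * r + 2) * g"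
    by (metis braid3_left_inverse mult.assoc mult_1_right)
  also have "\<dots> = g * Delta powi (3 * r + 2)"
    using Delta_powi_even_central[of "3 * r + 2" g] assms by simp
  finally have "(Delta powi r * eval_word [j, j]) ^ 3 = Delta powi (3 * r + 2) * eval_word []"
    by simp
  then have "Delta powi (3 * r) * eval_word [j, j, j, j, j, j] = Delta powi (3 * r + 2) * eval_word []"
    unfolding normal_power by (simp add: numeral_3_eq_3 even)
  then have "nf (Delta powi (3 * r) * eval_word [j, j, j, j, j, j]) =
      nf (Delta powi (3 * r + 2) * eval_word [])" by simp
  then show False
    by (subst (asm) nf_normal, simp, subst (asm) nf_normal) auto
qed

text \<open>Without equal neighbours, three letters from a two-letter alphabet would alternate and
  form an \<open>aba\<close>.\<close>

lemma aba_free_no_square: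
  assumes "aba_free w" "\<And>u a v. w \<noteq> u @ [a, a] @ v"
  shows "w = [] \<or> (\<exists>i. w = [i]) \<or> (\<exists>i. w = [i, flip i])"
proof (cases w rule: aba_free.cases)
  case (1 a b c w')
  then have "a \<noteq> b" "b \<noteq> c" using assms(2)[of "[]"] assms(2)[of "[a]"] by auto
  then have "a = c" by (cases a; cases b; cases c) auto
  then show ?thesis using assms(1) 1 \<open>a \<noteq> b\<close> by simp
next
  case ("2_3" a b)
  then have "a \<noteq> b" using assms(2)[of "[]"] by auto
  then show ?thesis using "2_3" neq_imp_flip by blast
qed auto

section \<open>Syllables\<close>

lemma eval_word_replicate: "eval_word (replicate n i) = xgen i ^ n"
  by (induction n) auto

definition syllable_word :: "(gen_idx \<times> nat) list \<Rightarrow> gen_idx list" where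
  "syllable_word ss = concat (map (\<lambda>(i, s). replicate s i) ss)"

lemma eval_syllable_word:
  "eval_word (syllable_word ss) = prod_list (map (\<lambda>(i, s). xgen i ^ s) ss)"
  by (induction ss) (auto simp: syllable_word_def eval_word_replicate)

lemma syllable_word_Cons: "syllable_word ((i, s) # ss) = replicate s i @ syllable_word ss"
  by (simp add: syllable_word_def)

text \<open>Syllable boundaries are exactly the changes of letter. The claim about the head lets the
  induction see the change at the next boundary.\<close>

lemma syllable_word_changes:
  assumes "distinct_adj (map fst ss)" "\<forall>(i, s) \<in> set ss. s \<ge> 1" "ss \<noteq> []"
  shows "syllable_word ss \<noteq> [] \<and> hd (syllable_word ss) = fst (hd ss) \<and>
    length ss = changes (syllable_word ss) + 1"
  using assms
proof (induction ss)
  case (Cons p ss)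
  obtain i s where p: "p = (i, s)" by (cases p)
  have s: "s \<ge> 1" using Cons.prems p by auto
  then have rep: "replicate s i \<noteq> []" "hd (replicate s i) = i" "last (replicate s i) = i"
    by auto
  show ?case
  proof (cases "ss = []")
    case True
    then show ?thesis using rep by (simp add: p syllable_word_Cons syllable_word_def)
  next
    case False
    then have IH: "syllable_word ss \<noteq> []" "hd (syllable_word ss) = fst (hd ss)"
        "length ss = changes (syllable_word ss) + 1"
      using Cons by (auto simp: distinct_adj_Cons)
    moreover have "i \<noteq> fst (hd ss)"
      using Cons.prems False by (auto simp: distinct_adj_Cons p hd_map)
    ultimately show ?thesis
      using rep by (simp add: p syllable_word_Cons changes_append)
  qed
qed simp

theorem theorem3:
  fixes r :: int and W :: braid3 and ss :: "(gen_idx \<times> nat) list"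
  assumes "syllable_form ss W"
    and "summit_word r W"
  shows "super_summit_word r W \<longleftrightarrow>
    (even r \<and> W = 1 \<or>
     odd r \<and> (\<exists>i. W = xgen i) \<or>
     even r \<and> (\<exists>i j. i \<noteq> j \<and> W = xgen i * xgen j)) \<or>
    [int (length ss) + 1 = r] (mod 2)"
proof -
  define w where "w = syllable_word ss"
  have W: "W = eval_word w"
    using assms(1) by (simp add: syllable_form_def w_def eval_syllable_word)
  have aba: "aba_free w"
    using assms(2) W by (simp add: summit_word_def eval_word_mem_MB3_plus_iff)
  have summit: "summit_word r (eval_word w)"
    using assms(2) W by simp
  define C where "C = conj_class (Delta powi r * eval_word w)"
  have super: "super_summit_word r W \<longleftrightarrow>
      (\<forall>w'. aba_free w' \<longrightarrow> Delta powi r * eval_word w' \<in> C \<longrightarrow> changes w' \<le> changes w)"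
    unfolding W C_def using super_summit_word_iff[OF aba summit] .
  have len: "length w' = length w" if "Delta powi r * eval_word w' \<in> C" for w'
    using that conj_class_length_eq unfolding C_def by blast
  have ss: "ss = [] \<and> w = [] \<or> w \<noteq> [] \<and> length ss = changes w + 1"
    using syllable_word_changes[of ss] assms(1) unfolding syllable_form_def w_def
    by (cases "ss = []") (simp_all add: syllable_word_def)
  have W1: "W = 1 \<longleftrightarrow> w = []"
    using eval_word_inject[of w "[]"] aba W by simp
  have Wx: "W = xgen i \<longleftrightarrow> w = [i]" for i
    using eval_word_inject[of w "[i]"] aba W by simp
  have Wxx: "W = xgen i * xgen j \<longleftrightarrow> w = [i, j]" for i j
    using eval_word_inject[of w "[i, j]"] aba W by simp
  define Exc where "Exc \<longleftrightarrow> even r \<and> w = [] \<or> odd r \<and> (\<exists>i. w = [i]) \<or> even r \<and> (\<exists>i j. i \<noteq> j \<and> w = [i, j])"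
  have mod2: "[int (length ss) + 1 = r] (mod 2) \<longleftrightarrow> even (int (length ss) + 1 - r)"
    by (simp add: cong_iff_dvd_diff)
  \<comment> \<open>Here \<open>length ss + 1\<close> is \<open>changes w + 2\<close>, and the
    twisted last letter differs from the first by \<open>r + changes w\<close> flips.\<close>
  have cyclic: "[int (length ss) + 1 = r] (mod 2) \<longleftrightarrow> twist r (last w) = hd w" if "w \<noteq> []"
  proof -
    have "twist r (last w) = twist (r + int (changes w)) (hd w)"
      using last_eq_twist_changes[OF that] by simp
    moreover have "twist s i = i \<longleftrightarrow> even s" for s i
      by (simp add: twist_def)
    ultimately show ?thesis
      using ss that unfolding mod2 by (auto simp: even_add)
  qed
  \<comment> \<open>One less than the length is the largest possible number of changes, and all
    competitors have the same length.\<close>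
  have max_changes: "super_summit_word r W" if "changes w + 1 \<ge> length w"
    unfolding super
  proof (intro allI impI)
    fix w' assume "Delta powi r * eval_word w' \<in> C"
    then show "changes w' \<le> changes w"
      using len[of w'] that changes_less_length[of w'] by (cases "w' = []") auto
  qed
  have "super_summit_word r W" if c: "[int (length ss) + 1 = r] (mod 2)"
  proof (cases "changes w + 1 \<ge> length w")
    case False
    then have "length w \<ge> 2" "w \<noteq> []" "changes w + 1 \<noteq> length w" by auto
    have rotate: "aba_free (map (twist r) v @ u)" if "Delta powi r * eval_word (u @ v) \<in> C" for u v
    proof -
      have "Delta powi r * eval_word (map (twist r) v @ u) \<in> C"
        using that rotation_mem_conj_class[of r v u] unfolding C_def conj_class_iff
        by clarsimp (metis braid3_inverse_mult mult.assoc)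
      then show ?thesis
        using summit_word_conj_aba_free[OF aba summit] unfolding C_def by blast
    qed
    have "cyclic_changes r w = changes w"
      using cyclic[OF \<open>w \<noteq> []\<close>] c by (simp add: cyclic_changes_def)
    have w_cyclic: "aba_free (map (twist r) w @ w)"
    proof (rule aba_free_cyclic)
      show "aba_free (map (twist r) v @ u)" if "w = u @ v" for u v
        using rotate[of u v] that self_mem_conj_class unfolding C_def by simp
    qed (use False \<open>length w \<ge> 2\<close> in auto)
    show ?thesis
      unfolding super
    proof (intro allI impI)
      fix w' assume w': "aba_free w'" "Delta powi r * eval_word w' \<in> C"
      show "changes w' \<le> changes w"
      \<comment> \<open>In the exceptional case \<open>w\<close> also has two letters but no change,
        so it is a square.\<close>
      proof (cases "length w' = 2 \<and> even r \<and> changes w' = 1")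
        case True
        then obtain i where i: "w' = [i, flip i]"
          using neq_imp_flip by (cases w' rule: aba_free.cases) (auto split: if_splits)
        obtain j where "w = [j, j]"
          using True False len[OF w'(2)] by (cases w rule: aba_free.cases) (auto split: if_splits)
        then show ?thesis
          using square_not_conj_alternating[of r i j] w'(2) i True unfolding C_def by blast
      next
        case notalt: False
        have "aba_free (map (twist r) w' @ w')"
          using notalt rotate w' len[OF w'(2)] \<open>length w \<ge> 2\<close> by (intro aba_free_cyclic) auto
        then have "cyclic_changes r w' = cyclic_changes r w"
          using w' w_cyclic len[OF w'(2)] \<open>length w \<ge> 2\<close> unfolding C_def
          by (intro cyclic_changes_conj_class) auto
        \<comment> \<open>The junction term is nonnegative, so \<open>changes w'\<close> is at most
          the common cyclic count.\<close>
        then show ?thesis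
          using \<open>cyclic_changes r w = changes w\<close> by (simp add: cyclic_changes_def)
      qed
    qed
  qed (rule max_changes)
  moreover have "super_summit_word r W" if Exc
    using that by (intro max_changes) (auto simp: Exc_def)
  moreover have Exc if sup: "super_summit_word r W" and c: "\<not> [int (length ss) + 1 = r] (mod 2)"
  proof (cases "w = []")
    case True
    \<comment> \<open>For the empty word \<open>length ss\<close> is 0, so failure of the congruence
      means that \<open>r\<close> is even.\<close>
    then show ?thesis using c ss unfolding mod2 Exc_def by auto
  next
    case False
    then have junction: "twist r (last w) \<noteq> hd w" using c cyclic by simp
    have "w \<noteq> u @ [a, a] @ v" for u a v
    proof
      assume w: "w = u @ [a, a] @ v"
      \<comment> \<open>The rotation that cuts \<open>w\<close> between the two equal letters: the
        cut destroys no change, while the old junction moves inside and adds one.\<close>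
      define x where "x = map (twist r) (a # v) @ (u @ [a])"
      have "Delta powi r * eval_word x \<in> C"
        using rotation_mem_conj_class[of r "a # v" "u @ [a]"] w by (simp add: x_def C_def)
      moreover from this have "aba_free x"
        using summit_word_conj_aba_free[OF aba summit] unfolding C_def by blast
      ultimately have "changes x \<le> changes w" using sup super by blast
      moreover have "changes x = changes (a # v) + 1 + changes (u @ [a])"
      proof -
        have "last (map (twist r) (a # v)) = twist r (last w)"
          by (simp add: w last_map del: list.map)
        moreover have "hd (u @ [a]) = hd w" by (simp add: w hd_append)
        ultimately show ?thesis
          unfolding x_def using junction
          by (subst changes_append) (simp_all del: list.map)
      qed
      moreover have "changes w = changes (u @ [a]) + changes (a # v)"
        using changes_append[of "u @ [a]" "a # v"] w by simp
      ultimately show False by simp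
    qed
    \<comment> \<open>The junction condition now fixes the parity: \<open>r\<close> is odd for one
      letter and even for two.\<close>
    then consider i where "w = [i]" | i where "w = [i, flip i]"
      using aba_free_no_square[OF aba] False by blast
    then show ?thesis
    proof cases
      case 1
      then show ?thesis using junction by (auto simp: Exc_def twist_def)
    next
      case (2 i)
      then have "even r" using junction by (auto simp: twist_def split: if_splits)
      then show ?thesis using 2 flip_neq unfolding Exc_def by blast
    qed
  qed
  ultimately have "super_summit_word r W \<longleftrightarrow> Exc \<or> [int (length ss) + 1 = r] (mod 2)"
    by blast
  then show ?thesis
    unfolding Exc_def W1 Wx Wxx .
qed

end
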